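(* Let $0<p<\infty$. The set $L_{p}[0,1]\setminus\bigcup_{q\in(p,\infty)}L_{q}[0,1]$ is $(n,\aleph_{0})$-dense lineable in $L_p[0,1]$, for each $n\in\mathbb{N}$.
   Context: $\mathbb{K}$ denotes $\mathbb{R}$ or $\mathbb{C}$; $\mathbb{N}$ is the set of positive integers; $L_p[0,1]$ is the usual Lebesgue space of (classes of) $\mathbb{K}$-valued functions on $[0,1]$ with its usual norm ($p\ge1$) or $p$-norm ($0<p<1$) topology. Dimension means algebraic (Hamel) dimension. A subset $A$ of a vector space $V$ is $\alpha$-lineable if $A\cup\{0\}$ contains an $\alpha$-dimensional vector subspace of $V$. If $V$ is a vector space endowed with a topology, a non-empty subset $A\subset V$ is $(\alpha,\beta)$-dense lineable if it is $\alpha$-lineable and for each $\alpha$-dimensional subspace $W_{\alpha}\subset A\cup\{0\}$ there is a $\beta$-dimensional dense subspace $W_{\beta}$ of $V$ such that $W_{\alpha}\subset W_{\beta}\subset A\cup\{0\}$. *)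

theory Defs
  imports "HOL-Analysis.Analysis"
begin

unbundle cardinal_syntax

text \<open>
  Vector spaces are given by a scaling function \<open>s\<close>, and cardinals by arbitrary cardinal order
  relations, so that \<open>|{..<n}|\<close> and \<open>natLeq\<close> stand for \<open>n\<close> and \<open>\<aleph>\<^sub>0\<close>. The library function
  \<open>dim\<close> is not used since it is \<open>0\<close> on every infinite-dimensional subspace.
\<close>

definition dim_subspace ::
    "('k::field \<Rightarrow> 'v::ab_group_add \<Rightarrow> 'v) \<Rightarrow> 'c rel \<Rightarrow> 'v set \<Rightarrow> bool" where
  "dim_subspace s \<alpha> W \<longleftrightarrow> module.subspace s W \<and>
     (\<exists>B. \<not> module.dependent s B \<and> module.span s B = W \<and> ( |B|, \<alpha>) \<in> ordIso)"

definition lineable ::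
    "('k::field \<Rightarrow> 'v::ab_group_add \<Rightarrow> 'v) \<Rightarrow> 'c rel \<Rightarrow> 'v set \<Rightarrow> bool" where
  "lineable s \<alpha> A \<longleftrightarrow> (\<exists>W. dim_subspace s \<alpha> W \<and> W \<subseteq> A \<union> {0})"

text \<open>The ambient topological vector space is \<open>topspace T\<close>, a linear subspace of the type \<open>'v\<close>.\<close>

definition dense_lineable ::
    "('k::field \<Rightarrow> 'v::ab_group_add \<Rightarrow> 'v) \<Rightarrow> 'v topology \<Rightarrow> 'c rel \<Rightarrow> 'd rel \<Rightarrow> 'v set \<Rightarrow> bool" where
  "dense_lineable s T \<alpha> \<beta> A \<longleftrightarrow>
     A \<noteq> {} \<and> A \<subseteq> topspace T \<and> lineable s \<alpha> A \<and>
     (\<forall>W. dim_subspace s \<alpha> W \<and> W \<subseteq> A \<union> {0} \<longrightarrow>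
       (\<exists>W'. dim_subspace s \<beta> W' \<and> T closure_of W' = topspace T \<and>
             W \<subseteq> W' \<and> W' \<subseteq> A \<union> {0}))"

text \<open>
  The type of all classes of Lebesgue measurable functions on \<open>[0,1]\<close> modulo equality almost
  everywhere; all spaces \<open>L\<^sub>p[0,1]\<close> are subspaces of it. The representatives are functions on all
  of \<open>real\<close> whose values outside \<open>[0,1]\<close> are irrelevant.
\<close>

definition ae_rel ::
    "(real \<Rightarrow> 'k::{real_normed_field, second_countable_topology}) \<Rightarrow> (real \<Rightarrow> 'k) \<Rightarrow> bool" where
  "ae_rel f g \<longleftrightarrow>
     f \<in> borel_measurable (lebesgue_on {0..1}) \<and> g \<in> borel_measurable (lebesgue_on {0..1}) \<and>
     (AE x in lebesgue_on {0..1}. f x = g x)"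

lemma part_equivp_ae_rel:
  "part_equivp (ae_rel :: (real \<Rightarrow> 'k::{real_normed_field, second_countable_topology}) \<Rightarrow> _)"
proof (rule part_equivpI)
  show "\<exists>f::real \<Rightarrow> 'k. ae_rel f f"
    by (rule exI[of _ "\<lambda>_. 0"]) (simp add: ae_rel_def)
  show "symp (ae_rel :: (real \<Rightarrow> 'k) \<Rightarrow> _)"
    by (auto simp: symp_def ae_rel_def eq_commute)
  show "transp (ae_rel :: (real \<Rightarrow> 'k) \<Rightarrow> _)"
    by (auto simp: transp_def ae_rel_def)
qed

quotient_type (overloaded) 'k L0 =
    "real \<Rightarrow> 'k::{real_normed_field, second_countable_topology}" / partial: ae_rel
  by (rule part_equivp_ae_rel)

instantiation L0 :: ("{real_normed_field, second_countable_topology}") ab_group_add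
begin

lift_definition zero_L0 :: "'a L0" is "\<lambda>_. 0"
  by (simp add: ae_rel_def)

lift_definition plus_L0 :: "'a L0 \<Rightarrow> 'a L0 \<Rightarrow> 'a L0" is "\<lambda>f g x. f x + g x"
  by (auto simp: ae_rel_def)

lift_definition uminus_L0 :: "'a L0 \<Rightarrow> 'a L0" is "\<lambda>f x. - f x"
  by (auto simp: ae_rel_def)

lift_definition minus_L0 :: "'a L0 \<Rightarrow> 'a L0 \<Rightarrow> 'a L0" is "\<lambda>f g x. f x - g x"
  by (auto simp: ae_rel_def)

instance
  by standard (transfer; force simp: ae_rel_def algebra_simps)+

end

lift_definition scaleL0 ::
    "'k::{real_normed_field, second_countable_topology} \<Rightarrow> 'k L0 \<Rightarrow> 'k L0" is "\<lambda>c f x. c * f x"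
  by (auto simp: ae_rel_def)

lemma vector_space_scaleL0: "vector_space scaleL0"
  by unfold_locales (transfer; force simp: ae_rel_def algebra_simps)+

lift_definition Lp_integrable ::
    "real \<Rightarrow> 'k::{real_normed_field, second_countable_topology} L0 \<Rightarrow> bool" is
  "\<lambda>p f. integrable (lebesgue_on {0..1}) (\<lambda>x. norm (f x) powr p)"
  unfolding ae_rel_def by (intro integrable_cong_AE) auto

definition Lp :: "real \<Rightarrow> 'k::{real_normed_field, second_countable_topology} L0 set" where
  "Lp p = {f. Lp_integrable p f}"

text \<open>A norm on \<open>Lp p\<close> if \<open>p \<ge> 1\<close> and a \<open>p\<close>-norm if \<open>0 < p < 1\<close>.\<close>

lift_definition Lp_norm ::
    "real \<Rightarrow> 'k::{real_normed_field, second_countable_topology} L0 \<Rightarrow> real" is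
  "\<lambda>p f. (LINT x|lebesgue_on {0..1}. norm (f x) powr p) powr (1 / p)"
  unfolding ae_rel_def by (intro arg_cong2[where f = "(powr)"] integral_cong_AE) auto

definition Lp_topology ::
    "real \<Rightarrow> 'k::{real_normed_field, second_countable_topology} L0 topology" where
  "Lp_topology p = topology (\<lambda>U. U \<subseteq> Lp p \<and>
     (\<forall>f\<in>U. \<exists>r>0. \<forall>g\<in>Lp p. Lp_norm p (g - f) < r \<longrightarrow> g \<in> U))"

lemma openin_Lp_topology:
  fixes U :: "'a::{real_normed_field, second_countable_topology} L0 set"
  shows "openin (Lp_topology p) U \<longleftrightarrow>
     U \<subseteq> Lp p \<and> (\<forall>f\<in>U. \<exists>r>0. \<forall>g\<in>Lp p. Lp_norm p (g - f) < r \<longrightarrow> g \<in> U)"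
proof -
  let ?P = "\<lambda>U :: 'a L0 set. U \<subseteq> Lp p \<and> (\<forall>f\<in>U. \<exists>r>0. \<forall>g\<in>Lp p. Lp_norm p (g - f) < r \<longrightarrow> g \<in> U)"
  have "istopology ?P"
    unfolding istopology_def
  proof (intro conjI allI impI)
    fix S T :: "'a L0 set" assume ST: "?P S" "?P T"
    show "S \<inter> T \<subseteq> Lp p"
      using ST by blast
    show "\<forall>f\<in>S \<inter> T. \<exists>r>0. \<forall>g\<in>Lp p. Lp_norm p (g - f) < r \<longrightarrow> g \<in> S \<inter> T"
    proof
      fix f assume "f \<in> S \<inter> T"
      then obtain r r' where "r > 0" "r' > 0"
        "\<forall>g\<in>Lp p. Lp_norm p (g - f) < r \<longrightarrow> g \<in> S"
        "\<forall>g\<in>Lp p. Lp_norm p (g - f) < r' \<longrightarrow> g \<in> T"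
        using ST by blast
      then show "\<exists>r>0. \<forall>g\<in>Lp p. Lp_norm p (g - f) < r \<longrightarrow> g \<in> S \<inter> T"
        by (intro exI[of _ "min r r'"]) auto
    qed
  next
    fix \<K> :: "'a L0 set set" assume *: "\<forall>K\<in>\<K>. ?P K"
    show "\<Union>\<K> \<subseteq> Lp p"
      using * by blast
    show "\<forall>f\<in>\<Union>\<K>. \<exists>r>0. \<forall>g\<in>Lp p. Lp_norm p (g - f) < r \<longrightarrow> g \<in> \<Union>\<K>"
      using * by (meson UnionE UnionI)
  qed
  then show ?thesis
    unfolding Lp_topology_def by (simp add: topology_inverse')
qed

lemma topspace_Lp_topology: "topspace (Lp_topology p) = Lp p"
proof -
  have "openin (Lp_topology p) (Lp p)"
    unfolding openin_Lp_topology by (auto intro: exI[of _ 1])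
  then show ?thesis
    using openin_subset[of "Lp_topology p" "Lp p"] openin_Lp_topology[of p "topspace (Lp_topology p)"]
    by auto
qed

lemma Lp_integrable_add:
  fixes f g :: "'a::{real_normed_field, second_countable_topology} L0"
  assumes "p > 0" "Lp_integrable p f" "Lp_integrable p g"
  shows "Lp_integrable p (f + g)"
  using assms
proof transfer
  fix p :: real and f g :: "real \<Rightarrow> 'a"
  assume p: "p > 0" and fg: "ae_rel f f" "ae_rel g g"
    and int: "integrable (lebesgue_on {0..1}) (\<lambda>x. norm (f x) powr p)"
      "integrable (lebesgue_on {0..1}) (\<lambda>x. norm (g x) powr p)"
  have [measurable]: "f \<in> borel_measurable (lebesgue_on {0..1})"
    "g \<in> borel_measurable (lebesgue_on {0..1})"
    using fg by (auto simp: ae_rel_def)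
  have bound: "norm (a + b) powr p \<le> 2 powr p * (norm a powr p + norm b powr p)" for a b :: 'a
  proof -
    have "norm (a + b) powr p \<le> (2 * max (norm a) (norm b)) powr p"
      using p norm_triangle_ineq[of a b] by (intro powr_mono2) auto
    also have "\<dots> = 2 powr p * max (norm a) (norm b) powr p"
      by (simp add: powr_mult)
    also have "\<dots> \<le> 2 powr p * (norm a powr p + norm b powr p)"
      by (intro mult_left_mono) (auto simp: max_def)
    finally show ?thesis .
  qed
  show "integrable (lebesgue_on {0..1}) (\<lambda>x. norm (f x + g x) powr p)"
  proof (rule Bochner_Integration.integrable_bound)
    show "integrable (lebesgue_on {0..1})
        (\<lambda>x. 2 powr p * (norm (f x) powr p + norm (g x) powr p))"
      using int by simp
  qed (use bound in \<open>auto simp: abs_mult intro: order_trans\<close>)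
qed

lemma subspace_Lp:
  assumes "p > 0"
  shows "module.subspace scaleL0 (Lp p)"
proof -
  interpret vector_space scaleL0
    by (rule vector_space_scaleL0)
  show ?thesis
  proof (rule subspaceI)
    show "0 \<in> Lp p"
      unfolding Lp_def mem_Collect_eq by transfer simp
    show "f + g \<in> Lp p" if "f \<in> Lp p" "g \<in> Lp p" for f g
      using that Lp_integrable_add[OF assms] by (auto simp: Lp_def)
    show "scaleL0 c f \<in> Lp p" if "f \<in> Lp p" for c f
      using that unfolding Lp_def mem_Collect_eq
      by transfer (simp add: norm_mult powr_mult)
  qed
qed

end

theory Submission
  imports Defs "HOL-Real_Asymp.Real_Asymp"
begin

text \<open>
  Let \<open>U\<close> be the union of the spaces \<open>Lp q\<close> with \<open>q > p\<close>. The measure is finite, so \<open>U\<close> is a linear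
  subspace of \<open>Lp p\<close>, and a subspace \<open>W\<close> of \<open>Lp p\<close> is contained in \<open>(Lp p - U) \<union> {0}\<close> iff it meets
  \<open>U\<close> in \<open>0\<close> only. The problem thus becomes linear algebra modulo \<open>U\<close>, together with two facts
  from analysis.

  First, \<open>Lp p\<close> has infinite dimension modulo \<open>U\<close>: there are functions \<open>spikes p k\<close> in \<open>Lp p\<close> with
  pairwise disjoint supports, none of which lies in \<open>U\<close>. They are independent modulo \<open>U\<close> since \<open>U\<close>
  is stable under restriction to measurable sets (\<open>spikes_independent_modulo\<close>). Any \<open>n\<close> of them span
  an \<open>n\<close>-dimensional subspace as required. Moreover, they tend to \<open>0\<close> in \<open>Lp p\<close>.

  Second, a subspace of \<open>Lp p\<close> is dense as soon as its closure contains the countably many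
  indicator functions of rays \<open>{..q}\<close> with rational \<open>q\<close> (\<open>closure_eq_Lp_if_limits\<close>). Being bounded,
  these indicators lie in \<open>U\<close>.

  Now let \<open>W\<close> be spanned by a finite independent set \<open>B\<close> and meet \<open>U\<close> trivially. By Steinitz
  exchange modulo \<open>U\<close>, some subsequence \<open>g\<close> of the spikes is independent of \<open>B\<close> modulo \<open>U\<close>, and it
  remains so when arbitrary elements of \<open>U\<close> are added to its members (\<open>extend_modulo_perturbed\<close>). Add
  to \<open>g k\<close> the \<open>k\<close>-th term of a list of the above indicators in which each of them occurs infinitely
  often. The resulting vectors together with \<open>B\<close> span a space of countably infinite dimension that
  contains \<open>W\<close> and meets \<open>U\<close> trivially, and it is dense because the \<open>g k\<close> tend to \<open>0\<close>.
\<close>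

section \<open>Independence modulo a subspace\<close>

context vector_space
begin

text \<open>
  Such a map is the quotient map by \<open>U\<close>, realised as a projection of the space itself along \<open>U\<close>
  so that no quotient type is needed.
\<close>

lemma ex_linear_with_kernel:
  assumes "subspace U"
  obtains Q where "Vector_Spaces.linear scale scale Q" "\<And>x. Q x = 0 \<longleftrightarrow> x \<in> U"
proof -
  interpret vector_space_pair scale scale ..
  obtain C where C: "C \<subseteq> U" "independent C" "U \<subseteq> span C"
    using maximal_independent_subset .
  let ?E = "extend_basis C"
  have E: "C \<subseteq> ?E" "independent ?E" "span ?E = UNIV"
    using C(2) by (simp_all add: extend_basis_superset independent_extend_basis)
  obtain Q where Q: "Vector_Spaces.linear scale scale Q"
    and Q_eq: "\<And>x. x \<in> ?E \<Longrightarrow> Q x = (if x \<in> C then 0 else x)"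
    using linear_independent_extend[OF E(2), of "\<lambda>x. if x \<in> C then 0 else x"] by blast
  interpret Q: Vector_Spaces.linear scale scale Q by (rule Q)
  have QC: "Q x = 0" if "x \<in> span C" for x
    using Q_eq E(1) by (intro Q.eq_0_on_span[OF _ that]) auto
  have QR: "Q x = x" if "x \<in> span (?E - C)" for x
    using that
  proof (induction rule: span_induct_alt)
    case base
    show ?case by (rule Q.zero)
  next
    case (step c x y)
    then show ?case using Q_eq by (simp add: Q.add Q.scale)
  qed
  have "Q x = 0 \<longleftrightarrow> x \<in> U" for x
  proof
    assume "Q x = 0"
    have "x \<in> span (C \<union> (?E - C))"
      using E(1,3) by (simp add: Un_absorb1)
    then obtain u r where ur: "x = u + r" "u \<in> span C" "r \<in> span (?E - C)"
      unfolding span_Un by blast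
    then have "r = 0"
      using \<open>Q x = 0\<close> by (simp add: Q.add QC QR)
    then show "x \<in> U"
      using ur C(1) assms span_minimal by auto
  qed (use C(3) QC in auto)
  with Q show ?thesis
    by (rule that)
qed

lemma independent_if_independent_image:
  assumes "Vector_Spaces.linear scale scale Q" "inj_on Q D" "independent (Q ` D)"
  shows "independent D"
proof
  interpret Q: Vector_Spaces.linear scale scale Q by fact
  assume "dependent D"
  then obtain a where a: "a \<in> D" "a \<in> span (D - {a})"
    unfolding dependent_def by blast
  then have "Q a \<in> span (Q ` (D - {a}))"
    by (simp add: Q.span_image)
  also have "Q ` (D - {a}) = Q ` D - {Q a}"
    using a(1) assms(2) by (auto simp: inj_on_def)
  finally show False
    using assms(3) a(1) unfolding dependent_def by blast
qed

text \<open>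
  In a relation \<open>\<Sum>k\<in>F. c k *s g k \<in> U\<close>, applying \<open>P j\<close> isolates the \<open>j\<close>-th term, so that \<open>c j *s g j \<in> U\<close>
  and hence \<open>c j = 0\<close>. The \<open>P j\<close> will be the restrictions of functions to disjoint sets.
\<close>

lemma independent_modulo_if_separated:
  fixes g :: "nat \<Rightarrow> 'b"
  assumes U: "subspace U" and g: "\<And>j. g j \<notin> U"
    and P: "\<And>j. Vector_Spaces.linear scale scale (P j)" "\<And>j x. x \<in> U \<Longrightarrow> P j x \<in> U"
    and Pg: "\<And>j k. P j (g k) = (if j = k then g k else 0)"
  shows "inj g" "independent (range g)" "span (range g) \<inter> U \<subseteq> {0}"
proof -
  have nz: "g j \<noteq> 0" for j
    using g[of j] subspace_0[OF U] by auto
  have coeff: "c j = 0" if "finite F" "j \<in> F" "(\<Sum>k\<in>F. c k *s g k) \<in> U" for F c j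
  proof -
    interpret P: Vector_Spaces.linear scale scale "P j" by (rule P)
    have "P j (\<Sum>k\<in>F. c k *s g k) = (\<Sum>k\<in>F. if k = j then c k *s g k else 0)"
      by (simp add: P.sum P.scale Pg if_distrib eq_commute cong: if_cong)
    also have "\<dots> = c j *s g j"
      using that by simp
    finally have "c j *s g j \<in> U"
      using P(2) that(3) by metis
    then have "inverse (c j) *s c j *s g j \<in> U"
      by (rule subspace_scale[OF U])
    then show "c j = 0"
      using g[of j] by (cases "c j = 0") auto
  qed
  show inj: "inj g"
    by (rule injI) (metis Pg nz)
  have sum: "(\<Sum>v\<in>t. r v *s v) = (\<Sum>k\<in>g -` t. r (g k) *s g k) \<and> finite (g -` t)"
    if "finite t" "t \<subseteq> range g" for t r
  proof -
    have "g ` (g -` t) = t"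
      using that by auto
    then show ?thesis
      using inj that sum.reindex[of g "g -` t" "\<lambda>v. r v *s v"]
      by (auto simp: inj_on_def intro: finite_vimageI)
  qed
  show "independent (range g)"
    unfolding independent_explicit_finite_subsets
  proof (intro allI impI ballI)
    fix t :: "'b set" and r :: "'b \<Rightarrow> 'a" and v :: 'b
    assume t: "t \<subseteq> range g" "finite t" "(\<Sum>v\<in>t. r v *s v) = 0" "v \<in> t"
    then obtain j where "v = g j" "j \<in> g -` t" by auto
    then show "r v = 0"
      using sum[OF t(2,1), of r] t(3) coeff[of "g -` t" j "\<lambda>k. r (g k)"] subspace_0[OF U] by auto
  qed
  show "span (range g) \<inter> U \<subseteq> {0}"
  proof
    fix x assume x: "x \<in> span (range g) \<inter> U"
    then obtain t r where t: "finite t" "t \<subseteq> range g" "x = (\<Sum>v\<in>t. r v *s v)"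
      unfolding span_explicit by blast
    then have "r (g j) = 0" if "j \<in> g -` t" for j
      using coeff[of "g -` t" j "\<lambda>k. r (g k)"] sum[OF t(1,2), of r] x that by auto
    then show "x \<in> {0}"
      using sum[OF t(1,2), of r] t(3) by simp
  qed
qed

text \<open>
  Work modulo \<open>U\<close>. The images of \<open>B\<close> and of the vectors \<open>g j\<close> are independent families there, the
  second one infinite and the first one finite, so by Steinitz exchange infinitely many of the
  \<open>g j\<close> extend \<open>B\<close> to an independent family. Modulo \<open>U\<close> the perturbations \<open>d k \<in> U\<close> are
  invisible, so one \<open>\<sigma>\<close> serves all of them. Taking \<open>\<sigma>\<close> strictly increasing (instead of an arbitrary
  sequence of members of \<open>g\<close>) keeps limit properties of \<open>g\<close>.
\<close>

lemma extend_modulo_perturbed: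
  fixes g :: "nat \<Rightarrow> 'b"
  assumes U: "subspace U"
    and B: "finite B" "independent B" "span B \<inter> U \<subseteq> {0}"
    and g: "inj g" "independent (range g)" "span (range g) \<inter> U \<subseteq> {0}"
  obtains \<sigma> :: "nat \<Rightarrow> nat" where "strict_mono \<sigma>"
    and "\<And>d. range d \<subseteq> U \<Longrightarrow> inj (\<lambda>k. d k + g (\<sigma> k)) \<and>
      independent (B \<union> range (\<lambda>k. d k + g (\<sigma> k))) \<and>
      span (B \<union> range (\<lambda>k. d k + g (\<sigma> k))) \<inter> U \<subseteq> {0}"
proof -
  obtain Q where Q: "Vector_Spaces.linear scale scale Q" and ker: "\<And>x. Q x = 0 \<longleftrightarrow> x \<in> U"
    using ex_linear_with_kernel[OF U] by blast
  interpret Q: Vector_Spaces.linear scale scale Q by (rule Q)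
  have inj_span: "inj_on Q (span S)" if "span S \<inter> U \<subseteq> {0}" for S
    using that ker by (subst Q.inj_on_iff_eq_0[OF subspace_span]) auto
  have QB: "independent (Q ` B)" and Qg: "independent (Q ` range g)"
    using B g by (simp_all add: Q.independent_injective_image inj_span)
  have inj_B: "inj_on Q B" and inj_Qg: "inj_on Q (range g)"
    using inj_span[OF B(3)] inj_span[OF g(3)] by (meson inj_on_subset span_superset)+
  \<comment> \<open>Complete the image of \<open>B\<close> by images of vectors \<open>g j\<close> only; \<open>J\<close> is the set of the indices used.\<close>
  obtain E where E: "Q ` B \<subseteq> E" "E \<subseteq> Q ` B \<union> Q ` range g" "independent E"
      "Q ` B \<union> Q ` range g \<subseteq> span E"
    using maximal_independent_subset_extend[OF Un_upper1 QB] by metis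
  have "infinite (Q ` range g)"
    using g(1) inj_Qg finite_imageD by (metis infinite_UNIV_nat)
  then have "infinite E"
    using independent_span_bound[of E, OF _ Qg] E(4) by auto
  define J where "J = {j. Q (g j) \<in> E - Q ` B}"
  have "E \<subseteq> Q ` B \<union> (Q \<circ> g) ` J"
    using E(2) by (auto simp: J_def)
  with \<open>infinite E\<close> B(1) have "infinite J"
    using finite_subset by blast
  define \<sigma> where "\<sigma> = enumerate J"
  have \<sigma>: "strict_mono \<sigma>" "\<sigma> k \<in> J" for k
    using \<open>infinite J\<close> by (auto simp: \<sigma>_def strict_mono_enumerate enumerate_in_set)
  have "inj (\<lambda>k. d k + g (\<sigma> k)) \<and>
      independent (B \<union> range (\<lambda>k. d k + g (\<sigma> k))) \<and>
      span (B \<union> range (\<lambda>k. d k + g (\<sigma> k))) \<inter> U \<subseteq> {0}" if d: "range d \<subseteq> U" for d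
  proof -
    let ?h = "\<lambda>k. d k + g (\<sigma> k)"
    have "Q (d k) = 0" for k
      using ker d by auto
    then have Qh: "Q (?h k) = Q (g (\<sigma> k))" for k
      by (simp add: Q.add)
    have inj_Qh: "inj (\<lambda>k. Q (?h k))"
      unfolding Qh using comp_inj_on[OF strict_mono_imp_inj_on[OF \<sigma>(1), of UNIV] inj_on_subset[OF comp_inj_on[OF g(1) inj_Qg]]]
      by (simp add: comp_def)
    then have inj_h: "inj ?h"
      by (auto simp: inj_on_def)
    have Qh_notin: "Q (?h k) \<notin> Q ` B" for k
      using \<sigma>(2) by (simp add: J_def Qh)
    have inj_Q: "inj_on Q (B \<union> range ?h)"
      unfolding inj_on_Un
    proof (intro conjI)
      show "inj_on Q (range ?h)"
        using inj_Qh by (auto simp: inj_on_def)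
      show "Q ` (B - range ?h) \<inter> Q ` (range ?h - B) = {}"
      proof (rule equals0I)
        fix y assume "y \<in> Q ` (B - range ?h) \<inter> Q ` (range ?h - B)"
        then obtain b k where "b \<in> B" "y = Q b" "y = Q (?h k)"
          by blast
        then show False
          using Qh_notin[of k] by simp
      qed
    qed (rule inj_B)
    have "Q ` (B \<union> range ?h) \<subseteq> E"
      using E(1) \<sigma>(2) by (auto simp: J_def Qh)
    then have ind: "independent (Q ` (B \<union> range ?h))"
      using E(3) independent_mono by blast
    have "inj_on Q (span (B \<union> range ?h))"
      using ind inj_Q by (rule Q.inj_on_span_independent_image)
    then have "span (B \<union> range ?h) \<inter> U \<subseteq> {0}"
      unfolding Q.inj_on_iff_eq_0[OF subspace_span] using ker by auto
    with inj_h independent_if_independent_image[OF Q inj_Q ind] show ?thesis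
      by blast
  qed
  with \<sigma>(1) show ?thesis
    by (rule that)
qed

end

section \<open>Classes of functions and their modulars\<close>

lemma ae_rel_refl_iff: "ae_rel f f \<longleftrightarrow> f \<in> borel_measurable (lebesgue_on {0..1})"
  by (simp add: ae_rel_def)

lemma L0_cases:
  fixes f :: "'k::{real_normed_field, second_countable_topology} L0"
  obtains f' where "f' \<in> borel_measurable (lebesgue_on {0..1})" "f = abs_L0 f'"
  by (induction f rule: L0.abs_induct) (auto simp: ae_rel_refl_iff)

lemma abs_L0_eqI:
  fixes f g :: "real \<Rightarrow> 'k::{real_normed_field, second_countable_topology}"
  assumes "f \<in> borel_measurable (lebesgue_on {0..1})" "g \<in> borel_measurable (lebesgue_on {0..1})"
    and "AE x in lebesgue_on {0..1}. f x = g x"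
  shows "abs_L0 f = abs_L0 g"
  using assms by (intro Quotient3_rel_abs[OF Quotient3_L0]) (simp add: ae_rel_def)

lemmas abs_L0_arith =
  plus_L0.abs_eq[unfolded ae_rel_refl_iff]
  minus_L0.abs_eq[unfolded ae_rel_refl_iff]
  scaleL0.abs_eq[unfolded ae_rel_refl_iff]
  zero_L0.abs_eq[symmetric]

lemma abs_L0_in_Lp_iff:
  fixes f :: "real \<Rightarrow> 'k::{real_normed_field, second_countable_topology}"
  assumes "f \<in> borel_measurable (lebesgue_on {0..1})"
  shows "abs_L0 f \<in> Lp p \<longleftrightarrow> integrable (lebesgue_on {0..1}) (\<lambda>x. norm (f x) powr p)"
  using assms by (simp add: Lp_def Lp_integrable.abs_eq ae_rel_refl_iff)

text \<open>
  Multiplication by the class of an indicator function restricts a class to a set.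
\<close>

lift_definition mult_L0 ::
    "'k::{real_normed_field, second_countable_topology} L0 \<Rightarrow> 'k L0 \<Rightarrow> 'k L0" is
  "\<lambda>f g x. f x * g x"
  by (auto simp: ae_rel_def)

lemmas mult_L0_abs = mult_L0.abs_eq[unfolded ae_rel_refl_iff]

lemma linear_mult_L0: "Vector_Spaces.linear scaleL0 scaleL0 (mult_L0 f)"
  unfolding Vector_Spaces.linear_iff
  by (intro conjI allI vector_space_scaleL0; transfer; force simp: ae_rel_def algebra_simps)

definition ind_L0 :: "real set \<Rightarrow> 'k::{real_normed_field, second_countable_topology} L0" where
  "ind_L0 S = abs_L0 (indicator S)"

lemma ind_L0_empty: "ind_L0 {} = 0"
  by (simp add: ind_L0_def zero_L0.abs_eq indicator_def[abs_def])

text \<open>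
  The \<open>p\<close>-th power of \<^const>\<open>Lp_norm\<close>. It satisfies a triangle inequality up to the factor \<open>2 powr p\<close>
  for all \<open>p > 0\<close>, which makes a distinction between \<open>p \<ge> 1\<close> and \<open>p < 1\<close> superfluous.
\<close>

lift_definition Lp_modular ::
    "real \<Rightarrow> 'k::{real_normed_field, second_countable_topology} L0 \<Rightarrow> real" is
  "\<lambda>p f. LINT x|lebesgue_on {0..1}. norm (f x) powr p"
  unfolding ae_rel_def by (intro integral_cong_AE) auto

lemmas Lp_modular_abs = Lp_modular.abs_eq[unfolded ae_rel_refl_iff]

lemma Lp_norm_eq_modular: "Lp_norm p f = Lp_modular p f powr (1 / p)"
  by transfer simp

lemma Lp_modular_nonneg: "0 \<le> Lp_modular p f"
  by transfer simp

lemma Lp_modular_scale: "Lp_modular p (scaleL0 c f) = norm c powr p * Lp_modular p f"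
  by transfer (simp add: norm_mult powr_mult)

lemma norm_add_powr_le:
  fixes a b :: "'a::real_normed_vector"
  assumes "p > 0"
  shows "norm (a + b) powr p \<le> 2 powr p * (norm a powr p + norm b powr p)"
proof -
  have "norm (a + b) powr p \<le> (2 * max (norm a) (norm b)) powr p"
    using assms norm_triangle_ineq[of a b] by (intro powr_mono2) auto
  also have "\<dots> = 2 powr p * max (norm a) (norm b) powr p"
    by (simp add: powr_mult)
  also have "\<dots> \<le> 2 powr p * (norm a powr p + norm b powr p)"
    by (intro mult_left_mono) (auto simp: max_def)
  finally show ?thesis .
qed

lemma Lp_modular_add:
  assumes "p > 0" "f \<in> Lp p" "g \<in> Lp p"
  shows "Lp_modular p (f + g) \<le> 2 powr p * (Lp_modular p f + Lp_modular p g)"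
proof -
  have int: "Lp_integrable p f" "Lp_integrable p g" "Lp_integrable p (f + g)"
    using assms Lp_integrable_add by (auto simp: Lp_def)
  with assms(1) show ?thesis
  proof transfer
    fix p :: real and f g :: "real \<Rightarrow> 'a"
    assume "p > 0" and *: "integrable (lebesgue_on {0..1}) (\<lambda>x. norm (f x) powr p)"
      "integrable (lebesgue_on {0..1}) (\<lambda>x. norm (g x) powr p)"
      "integrable (lebesgue_on {0..1}) (\<lambda>x. norm (f x + g x) powr p)"
    have "(LINT x|lebesgue_on {0..1}. norm (f x + g x) powr p) \<le>
        (LINT x|lebesgue_on {0..1}. 2 powr p * (norm (f x) powr p + norm (g x) powr p))"
      using * \<open>p > 0\<close> by (intro integral_mono norm_add_powr_le) simp_all
    then show "(LINT x|lebesgue_on {0..1}. norm (f x + g x) powr p)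
         \<le> 2 powr p * ((LINT x|lebesgue_on {0..1}. norm (f x) powr p) +
            (LINT x|lebesgue_on {0..1}. norm (g x) powr p))"
      using * by simp
  qed
qed

lemma Lp_antimono:
  assumes "0 \<le> q" "q \<le> r"
  shows "Lp r \<subseteq> Lp q"
proof
  fix f :: "'a L0" assume "f \<in> Lp r"
  with assms show "f \<in> Lp q"
    unfolding Lp_def mem_Collect_eq
  proof transfer
    fix q r :: real and f :: "real \<Rightarrow> 'a"
    assume qr: "0 \<le> q" "q \<le> r" and f: "ae_rel f f" "integrable (lebesgue_on {0..1}) (\<lambda>x. norm (f x) powr r)"
    show "integrable (lebesgue_on {0..1}) (\<lambda>x. norm (f x) powr q)"
    proof (rule Bochner_Integration.integrable_bound)
      show "integrable (lebesgue_on {0..1}) (\<lambda>x. 1 + norm (f x) powr r)"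
        using f(2) by simp
      have "norm (f x) powr q \<le> 1 + norm (f x) powr r" for x
      proof (cases "norm (f x) \<le> 1")
        case True
        then have "norm (f x) powr q \<le> 1 powr q"
          using qr by (intro powr_mono2) auto
        then show ?thesis
          by (simp add: add_increasing2)
      next
        case False
        then have "norm (f x) powr q \<le> norm (f x) powr r"
          using qr by (intro powr_mono) auto
        then show ?thesis by simp
      qed
      then show "AE x in lebesgue_on {0..1}. norm (norm (f x) powr q) \<le> norm (1 + norm (f x) powr r)"
        by simp
    qed (use f(1) in \<open>auto simp: ae_rel_def\<close>)
  qed
qed

definition Lp_above :: "real \<Rightarrow> 'k::{real_normed_field, second_countable_topology} L0 set" where
  "Lp_above p = (\<Union>q\<in>{p<..}. Lp q)"

lemma Lp_above_subset: "0 < p \<Longrightarrow> Lp_above p \<subseteq> Lp p"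
  unfolding Lp_above_def by (intro UN_least Lp_antimono) auto

text \<open>
  On a space of finite measure the \<open>Lp q\<close> decrease in \<open>q\<close>, so the union is that of a chain of
  subspaces.
\<close>

lemma subspace_Lp_above:
  assumes "0 < p"
  shows "module.subspace scaleL0 (Lp_above p)"
proof -
  interpret vector_space scaleL0
    by (rule vector_space_scaleL0)
  note sub = subspace_Lp
  show ?thesis
  proof (rule subspaceI)
    show "0 \<in> Lp_above p"
      using assms subspace_0[OF sub, of "p + 1"] by (auto simp: Lp_above_def intro!: bexI[of _ "p + 1"])
    show "f + g \<in> Lp_above p" if fg: "f \<in> Lp_above p" "g \<in> Lp_above p" for f g
    proof -
      obtain q r where "p < q" "f \<in> Lp q" "p < r" "g \<in> Lp r"
        using fg by (auto simp: Lp_above_def)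
      moreover from this have "f \<in> Lp (min q r)" "g \<in> Lp (min q r)"
        using assms Lp_antimono[of "min q r" q] Lp_antimono[of "min q r" r] by auto
      ultimately show ?thesis
        using assms subspace_add[OF sub, of "min q r"]
        by (auto simp: Lp_above_def intro!: bexI[of _ "min q r"])
    qed
    show "scaleL0 c f \<in> Lp_above p" if "f \<in> Lp_above p" for c f
    proof -
      obtain q where "p < q" "f \<in> Lp q"
        using \<open>f \<in> Lp_above p\<close> by (auto simp: Lp_above_def)
      then show ?thesis
        using assms subspace_scale[OF sub, of q f c] by (auto simp: Lp_above_def)
    qed
  qed
qed

lemma indicator_measurable_lebesgue_on:
  assumes "S \<in> sets lebesgue"
  shows "(indicator S :: real \<Rightarrow> 'k::{real_normed_field, second_countable_topology})
    \<in> borel_measurable (lebesgue_on {0..1})"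
  using assms by (intro measurable_restrict_space1) auto

lemma mult_ind_L0_in_Lp:
  assumes S: "S \<in> sets lebesgue" and f: "f \<in> Lp q"
  shows "mult_L0 (ind_L0 S) f \<in> Lp q"
proof -
  note [measurable] = indicator_measurable_lebesgue_on[OF S]
  obtain f' where f'[measurable]: "f' \<in> borel_measurable (lebesgue_on {0..1})" and eq: "f = abs_L0 f'"
    by (rule L0_cases)
  have "integrable (lebesgue_on {0..1}) (\<lambda>x. norm (f' x) powr q)"
    using f f' by (simp add: eq abs_L0_in_Lp_iff)
  then have "integrable (lebesgue_on {0..1}) (\<lambda>x. norm (indicator S x * f' x) powr q)"
  proof (rule Bochner_Integration.integrable_bound)
    show "AE x in lebesgue_on {0..1}. norm (norm (indicator S x * f' x) powr q) \<le> norm (norm (f' x) powr q)"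
      by (simp add: indicator_def)
  qed simp
  then show ?thesis
    by (simp add: eq ind_L0_def mult_L0_abs abs_L0_in_Lp_iff)
qed

lemma bounded_in_Lp:
  fixes f :: "real \<Rightarrow> 'k::{real_normed_field, second_countable_topology}"
  assumes "f \<in> borel_measurable (lebesgue_on {0..1})" "\<And>x. norm (f x) \<le> c" "0 \<le> q"
  shows "abs_L0 f \<in> Lp q"
proof -
  have "integrable (lebesgue_on {0..1}) (\<lambda>x. norm (f x) powr q)"
  proof (rule Bochner_Integration.integrable_bound)
    show "integrable (lebesgue_on {0..1}) (\<lambda>x::real. c powr q)"
      by simp
  qed (use assms in \<open>auto intro!: powr_mono2\<close>)
  then show ?thesis
    using assms by (simp add: abs_L0_in_Lp_iff)
qed

lemma ind_L0_in_Lp: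
  assumes "S \<in> sets lebesgue" "0 \<le> q"
  shows "ind_L0 S \<in> Lp q"
  unfolding ind_L0_def using assms
  by (intro bounded_in_Lp[where c = 1] indicator_measurable_lebesgue_on) (auto simp: indicator_def)

lemma ind_L0_in_Lp_above:
  assumes "S \<in> sets lebesgue" "0 < p"
  shows "ind_L0 S \<in> Lp_above p"
  unfolding Lp_above_def using assms by (intro UN_I[of "p + 1"] ind_L0_in_Lp) auto

section \<open>A density criterion\<close>

text \<open>
  The sequential closure of \<open>W\<close>, as a subset of the topological closure. Membership is a plain
  \<open>\<epsilon>\<close>-condition, so that no continuity of the vector space operations has to be proved for the
  topology.
\<close>

definition Lp_limits ::
    "real \<Rightarrow> 'k::{real_normed_field, second_countable_topology} L0 set \<Rightarrow> 'k L0 set" where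
  "Lp_limits p W = {f \<in> Lp p. \<forall>e>0. \<exists>g\<in>W. Lp_modular p (g - f) < e}"

lemma Lp_limits_subset_closure:
  assumes "p > 0" "W \<subseteq> Lp p"
  shows "Lp_limits p W \<subseteq> Lp_topology p closure_of W"
proof
  fix f assume f: "f \<in> Lp_limits p W"
  show "f \<in> Lp_topology p closure_of W"
    unfolding in_closure_of topspace_Lp_topology
  proof (intro conjI allI impI)
    show "f \<in> Lp p"
      using f by (simp add: Lp_limits_def)
    fix T assume T: "f \<in> T \<and> openin (Lp_topology p) T"
    then obtain r where r: "r > 0" "\<And>g. g \<in> Lp p \<Longrightarrow> Lp_norm p (g - f) < r \<Longrightarrow> g \<in> T"
      by (auto simp: openin_Lp_topology)
    have "r powr p > 0"
      using r(1) by simp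
    then obtain g where g: "g \<in> W" "Lp_modular p (g - f) < r powr p"
      using f unfolding Lp_limits_def by blast
    then have "Lp_norm p (g - f) < (r powr p) powr (1 / p)"
      unfolding Lp_norm_eq_modular using assms(1) Lp_modular_nonneg
      by (intro powr_less_mono2) auto
    also have "\<dots> = r"
      using assms(1) r(1) by (simp add: powr_powr)
    finally show "\<exists>g. g \<in> W \<and> g \<in> T"
      using g(1) assms(2) r(2) by blast
  qed
qed

context
  fixes p :: real and W :: "'k::{real_normed_field, second_countable_topology} L0 set"
  assumes p: "p > 0" and W: "module.subspace scaleL0 W" "W \<subseteq> Lp p"
begin

interpretation vector_space "scaleL0 :: 'k \<Rightarrow> _"
  by (rule vector_space_scaleL0)

lemma Lp_modular_triangle:
  fixes f g h :: "'k L0"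
  assumes "f \<in> Lp p" "g \<in> Lp p" "h \<in> Lp p"
  shows "Lp_modular p (f - h) \<le> 2 powr p * (Lp_modular p (f - g) + Lp_modular p (g - h))"
proof -
  have "f - g \<in> Lp p" "g - h \<in> Lp p"
    using assms subspace_diff[OF subspace_Lp[OF p]] by auto
  from Lp_modular_add[OF p this] show ?thesis by simp
qed

lemma Lp_limits_closed:
  assumes f: "f \<in> Lp p" and "\<And>e. e > 0 \<Longrightarrow> \<exists>h\<in>Lp_limits p W. Lp_modular p (h - f) < e"
  shows "f \<in> Lp_limits p W"
  unfolding Lp_limits_def
proof (intro CollectI conjI allI impI f)
  fix e :: real assume "e > 0"
  define e' where "e' = e / (2 * 2 powr p)"
  have e': "e' > 0" "2 powr p * (e' + e') = e"
    using \<open>e > 0\<close> by (auto simp: e'_def)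
  obtain h where h: "h \<in> Lp_limits p W" "Lp_modular p (h - f) < e'"
    using assms(2) e'(1) by blast
  then obtain g where g: "g \<in> W" "Lp_modular p (g - h) < e'"
    using e'(1) by (auto simp: Lp_limits_def)
  have "Lp_modular p (g - f) \<le> 2 powr p * (Lp_modular p (g - h) + Lp_modular p (h - f))"
    using f h(1) g(1) W(2) by (intro Lp_modular_triangle) (auto simp: Lp_limits_def)
  also have "\<dots> < 2 powr p * (e' + e')"
    using g(2) h(2) by (intro mult_strict_left_mono) auto
  finally show "\<exists>g\<in>W. Lp_modular p (g - f) < e"
    using g(1) e'(2) by auto
qed

lemma subspace_Lp_limits: "subspace (Lp_limits p W)"
proof (rule subspaceI)
  have Lp_mod0: "Lp_modular p (0 :: 'k L0) = 0"
    by transfer simp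
  show "0 \<in> Lp_limits p W"
    using subspace_0[OF W(1)] subspace_0[OF subspace_Lp[OF p]]
    by (auto simp: Lp_limits_def Lp_mod0 intro!: bexI[of _ 0])
  show "f + g \<in> Lp_limits p W" if fg: "f \<in> Lp_limits p W" "g \<in> Lp_limits p W" for f g
    unfolding Lp_limits_def
  proof (intro CollectI conjI allI impI)
    show "f + g \<in> Lp p"
      using fg subspace_add[OF subspace_Lp[OF p]] by (auto simp: Lp_limits_def)
    fix e :: real assume "e > 0"
    define e' where "e' = e / (2 * 2 powr p)"
    have e': "e' > 0" "2 powr p * (e' + e') = e"
      using \<open>e > 0\<close> by (auto simp: e'_def)
    obtain f' g' where *: "f' \<in> W" "Lp_modular p (f' - f) < e'" "g' \<in> W" "Lp_modular p (g' - g) < e'"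
      using fg e'(1) unfolding Lp_limits_def by blast
    have "Lp_modular p ((f' - f) + (g' - g))
        \<le> 2 powr p * (Lp_modular p (f' - f) + Lp_modular p (g' - g))"
      using fg * W(2) subspace_diff[OF subspace_Lp[OF p]]
      by (intro Lp_modular_add p) (auto simp: Lp_limits_def)
    also have "\<dots> < 2 powr p * (e' + e')"
      using * by (intro mult_strict_left_mono) auto
    finally have "Lp_modular p ((f' + g') - (f + g)) < e"
      using e'(2) by (simp add: algebra_simps)
    then show "\<exists>h\<in>W. Lp_modular p (h - (f + g)) < e"
      using * subspace_add[OF W(1)] by blast
  qed
  show "scaleL0 c f \<in> Lp_limits p W" if f: "f \<in> Lp_limits p W" for c f
    unfolding Lp_limits_def
  proof (intro CollectI conjI allI impI)
    show "scaleL0 c f \<in> Lp p"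
      using f subspace_scale[OF subspace_Lp[OF p]] by (auto simp: Lp_limits_def)
    fix e :: real assume "e > 0"
    then have "e / (norm c powr p + 1) > 0"
      by (simp add: add_nonneg_pos)
    then obtain g where g: "g \<in> W" "Lp_modular p (g - f) < e / (norm c powr p + 1)"
      using f unfolding Lp_limits_def by blast
    have "Lp_modular p (scaleL0 c g - scaleL0 c f) = norm c powr p * Lp_modular p (g - f)"
      by (simp add: Lp_modular_scale flip: scale_right_diff_distrib)
    also have "\<dots> \<le> (norm c powr p + 1) * Lp_modular p (g - f)"
      by (intro mult_right_mono Lp_modular_nonneg) auto
    also have "\<dots> < e"
      using g(2) by (simp add: pos_less_divide_eq add_nonneg_pos mult.commute)
    finally show "\<exists>h\<in>W. Lp_modular p (h - scaleL0 c f) < e"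
      using g(1) subspace_scale[OF W(1)] by blast
  qed
qed

lemma Lp_limits_dominated:
  fixes F :: "nat \<Rightarrow> real \<Rightarrow> 'k" and b :: "real \<Rightarrow> real"
  assumes [measurable]: "\<And>n. F n \<in> borel_measurable (lebesgue_on {0..1})"
      "f \<in> borel_measurable (lebesgue_on {0..1})"
    and b: "integrable (lebesgue_on {0..1}) (\<lambda>x. b x powr p)"
    and bound: "\<And>n x. x \<in> {0..1} \<Longrightarrow> norm (F n x) \<le> b x"
    and lim: "\<And>x. x \<in> {0..1} \<Longrightarrow> (\<lambda>n. F n x) \<longlonglongrightarrow> f x"
    and mem: "\<And>n. abs_L0 (F n) \<in> Lp_limits p W"
  shows "abs_L0 f \<in> Lp_limits p W"
proof (rule Lp_limits_closed)
  have f_bound: "norm (f x) \<le> b x" if "x \<in> {0..1}" for x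
    using tendsto_norm[OF lim[OF that]] bound[OF that] by (intro LIMSEQ_le_const2) auto
  have "integrable (lebesgue_on {0..1}) (\<lambda>x. norm (f x) powr p)"
    using p f_bound
    by (intro Bochner_Integration.integrable_bound[OF b])
      (auto simp: space_restrict_space intro!: AE_I2 powr_mono2)
  then show "abs_L0 f \<in> Lp p"
    by (simp add: abs_L0_in_Lp_iff)
  have "(\<lambda>n. LINT x|lebesgue_on {0..1}. norm (F n x - f x) powr p)
      \<longlonglongrightarrow> (LINT x|lebesgue_on {0..1::real}. 0)"
  proof (rule integral_dominated_convergence)
    show "integrable (lebesgue_on {0..1}) (\<lambda>x. 2 powr p * b x powr p)"
      using b by simp
    show "AE x in lebesgue_on {0..1}. (\<lambda>n. norm (F n x - f x) powr p) \<longlonglongrightarrow> 0"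
    proof (rule AE_I2)
      fix x assume "x \<in> space (lebesgue_on {0..1::real})"
      then have "(\<lambda>n. norm (F n x - f x)) \<longlonglongrightarrow> 0"
        using lim[of x] by (simp add: space_restrict_space tendsto_norm_zero_iff LIM_zero_iff)
      then have "(\<lambda>n. norm (F n x - f x) powr p) \<longlonglongrightarrow> 0 powr p"
        using p by (intro tendsto_powr') auto
      then show "(\<lambda>n. norm (F n x - f x) powr p) \<longlonglongrightarrow> 0"
        by simp
    qed
    show "AE x in lebesgue_on {0..1}. norm (norm (F n x - f x) powr p) \<le> 2 powr p * b x powr p" for n
    proof (rule AE_I2)
      fix x assume "x \<in> space (lebesgue_on {0..1::real})"
      then have x: "x \<in> {0..1}"
        by (simp add: space_restrict_space)
      have "norm (F n x - f x) \<le> 2 * b x"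
        using norm_triangle_ineq4[of "F n x" "f x"] bound[OF x, of n] f_bound[OF x] by simp
      then have "norm (F n x - f x) powr p \<le> (2 * b x) powr p"
        using p by (intro powr_mono2) auto
      also have "\<dots> = 2 powr p * b x powr p"
        using order_trans[OF norm_ge_zero f_bound[OF x]] by (simp add: powr_mult)
      finally show "norm (norm (F n x - f x) powr p) \<le> 2 powr p * b x powr p"
        by simp
    qed
  qed simp_all
  then have "(\<lambda>n. Lp_modular p (abs_L0 (F n) - abs_L0 f)) \<longlonglongrightarrow> 0"
    by (simp add: abs_L0_arith Lp_modular_abs)
  then show "\<exists>h\<in>Lp_limits p W. Lp_modular p (h - abs_L0 f) < e" if "e > 0" for e
  proof -
    assume "(\<lambda>n. Lp_modular p (abs_L0 (F n) - abs_L0 f)) \<longlonglongrightarrow> 0"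
    then have "\<forall>\<^sub>F n in sequentially. Lp_modular p (abs_L0 (F n) - abs_L0 f) < e"
      using that by (rule order_tendstoD(2))
    then obtain n where "Lp_modular p (abs_L0 (F n) - abs_L0 f) < e"
      by (auto simp: eventually_sequentially)
    with mem show ?thesis
      by blast
  qed
qed

text \<open>
  The sets whose indicator is a limit form a Dynkin system, because limits form a closed subspace;
  it contains all rays \<open>{..a}\<close>, as decreasing limits of rational ones, and the rays generate the
  Borel sets and are stable under intersection.
\<close>

lemma Lp_limits_ind_borel:
  assumes q: "\<And>q. q \<in> \<rat> \<Longrightarrow> ind_L0 {..q} \<in> Lp_limits p W" and S: "S \<in> sets borel"
  shows "ind_L0 S \<in> Lp_limits p W"
proof -
  note sub = subspace_Lp_limits
  have meas [measurable]: "(indicator A :: real \<Rightarrow> 'k) \<in> borel_measurable (lebesgue_on {0..1})"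
    if "A \<in> sets borel" for A
    using that by (intro indicator_measurable_lebesgue_on) simp
  have limit: "ind_L0 A \<in> Lp_limits p W"
    if "A \<in> sets borel" "\<And>n. B n \<in> sets borel" "\<And>n. ind_L0 (B n) \<in> Lp_limits p W"
      "\<And>x. (\<lambda>n. indicator (B n) x :: 'k) \<longlonglongrightarrow> indicator A x" for A and B :: "nat \<Rightarrow> real set"
    unfolding ind_L0_def
  proof (rule Lp_limits_dominated[where F = "\<lambda>n. indicator (B n)" and b = "\<lambda>_. 1"])
    show "norm (indicator (B n) x :: 'k) \<le> 1" for n x
      by (simp add: indicator_def)
  qed (use that meas in \<open>simp_all add: ind_L0_def\<close>)
  have ray: "ind_L0 {..a} \<in> Lp_limits p W" for a
  proof -
    have "\<exists>r\<in>\<rat>. a < r \<and> r < a + inverse (real (Suc n))" for n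
      by (intro Rats_dense_in_real) simp
    then obtain r where r: "\<And>n. r n \<in> \<rat>" "\<And>n. a < r n" "\<And>n. r n < a + inverse (real (Suc n))"
      by metis
    have "r \<longlonglongrightarrow> a"
    proof (rule tendsto_sandwich[of "\<lambda>_. a" r sequentially "\<lambda>n. a + inverse (real (Suc n))"])
      show "(\<lambda>n. a + inverse (real (Suc n))) \<longlonglongrightarrow> a"
        using tendsto_add[OF tendsto_const LIMSEQ_inverse_real_of_nat, of a] by simp
      show "\<forall>\<^sub>F n in sequentially. a \<le> r n" "\<forall>\<^sub>F n in sequentially. r n \<le> a + inverse (real (Suc n))"
        using r(2,3) by (simp_all add: less_imp_le)
    qed simp
    show ?thesis
    proof (rule limit[of _ "\<lambda>n. {..r n}"])
      fix x :: real
      show "(\<lambda>n. indicator {..r n} x :: 'k) \<longlonglongrightarrow> indicator {..a} x"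
      proof (cases "x \<le> a")
        case True
        then have "x \<le> r n" for n
          using r(2)[of n] by simp
        with True show ?thesis by simp
      next
        case False
        then have "\<forall>\<^sub>F n in sequentially. r n < x"
          using \<open>r \<longlonglongrightarrow> a\<close> by (intro order_tendstoD(2)) auto
        then have "\<forall>\<^sub>F n in sequentially. indicator {..r n} x = (indicator {..a} x :: 'k)"
          by (rule eventually_mono) (use False in \<open>auto simp: indicator_def\<close>)
        then show ?thesis
          by (rule tendsto_eventually)
      qed
    qed (use q r in auto)
  qed
  \<comment> \<open>On \<open>[0,1]\<close> the whole line is the ray \<open>{..1}\<close>.\<close>
  have univ: "ind_L0 UNIV \<in> Lp_limits p W"
  proof -
    have "ind_L0 UNIV = (ind_L0 {..1} :: 'k L0)"
      unfolding ind_L0_def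
      by (intro abs_L0_eqI meas AE_I2) (auto simp: space_restrict_space indicator_def)
    then show ?thesis
      using ray by simp
  qed
  have borel_eq: "sigma_sets UNIV (range (\<lambda>a::real. {..a})) = sets borel"
    by (simp add: borel_eq_atMost)
  have "Int_stable (range (\<lambda>a::real. {..a}))"
    by (auto simp: Int_stable_def)
  moreover have "range (\<lambda>a::real. {..a}) \<subseteq> Pow UNIV"
    by simp
  moreover have "S \<in> sigma_sets UNIV (range (\<lambda>a::real. {..a}))"
    using S by (simp add: borel_eq)
  ultimately show ?thesis
  proof (induction S rule: sigma_sets_induct_disjoint)
    case (basic A)
    then show ?case using ray by auto
  next
    case empty
    show ?case
      using subspace_0[OF sub] by (simp add: ind_L0_empty)
  next
    case (compl A)
    then have [measurable]: "A \<in> sets borel"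
      by (simp add: borel_eq)
    have "ind_L0 (UNIV - A) = (ind_L0 UNIV - ind_L0 A :: 'k L0)"
      unfolding ind_L0_def
      by (subst abs_L0_arith) (auto intro!: arg_cong[where f = abs_L0] simp: fun_eq_iff indicator_def)
    then show ?case
      using subspace_diff[OF sub univ compl(2)] by simp
  next
    case (union A)
    then have A: "A n \<in> sets borel" for n
      by (auto simp: borel_eq)
    have partial: "ind_L0 (\<Union>i<n. A i) \<in> Lp_limits p W" for n
    proof (induction n)
      case 0
      show ?case
        using subspace_0[OF sub] by (simp add: ind_L0_empty)
    next
      case (Suc n)
      have [measurable]: "(\<Union>i<n. A i) \<in> sets borel"
        using A by auto
      have "x \<notin> A n" if "x \<in> A i" "i < n" for x i
        using disjoint_family_onD[OF union(1), of i n] that by auto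
      then have "indicator (\<Union>i<Suc n. A i) = (\<lambda>x. indicator (\<Union>i<n. A i) x + indicator (A n) x :: 'k)"
        by (force simp: fun_eq_iff lessThan_Suc indicator_def)
      then have "ind_L0 (\<Union>i<Suc n. A i) = (ind_L0 (\<Union>i<n. A i) + ind_L0 (A n) :: 'k L0)"
        unfolding ind_L0_def using A by (simp add: abs_L0_arith)
      then show ?case
        using subspace_add[OF sub Suc union(3)] by simp
    qed
    show ?case
    proof (rule limit[OF _ _ partial])
      fix x :: real
      show "(\<lambda>n. indicator (\<Union>i<n. A i) x :: 'k) \<longlonglongrightarrow> indicator (\<Union>i. A i) x"
        by (rule LIMSEQ_indicator_UN)
    qed (use A in auto)
  qed
qed

lemma Lp_limits_ind_lebesgue:
  assumes q: "\<And>q. q \<in> \<rat> \<Longrightarrow> ind_L0 {..q} \<in> Lp_limits p W" and S: "S \<in> sets lebesgue"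
  shows "ind_L0 S \<in> Lp_limits p W"
proof -
  let ?T = "main_part lborel S"
  have T: "?T \<in> sets borel"
    using main_part_sets[OF S] by simp
  obtain N where N: "N \<in> null_sets lborel" "null_part lborel S \<subseteq> N"
    using null_part[OF S] by blast
  then have "N \<in> null_sets lebesgue"
    by (auto intro: null_sets_completionI)
  then have "AE x in lebesgue. x \<notin> N"
    by (rule AE_not_in)
  then have "AE x in lebesgue_on {0..1}. x \<notin> N"
    by (auto simp: AE_restrict_space_iff)
  then have "AE x in lebesgue_on {0..1}. indicator S x = (indicator ?T x :: 'k)"
  proof eventually_elim
    case (elim x)
    then have "x \<in> S \<longleftrightarrow> x \<in> ?T"
      using main_part_null_part_Un[OF S] N(2) by blast
    then show ?case
      by (simp add: indicator_def)
  qed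
  then have "ind_L0 S = (ind_L0 ?T :: 'k L0)"
    unfolding ind_L0_def using S T by (intro abs_L0_eqI indicator_measurable_lebesgue_on) auto
  then show ?thesis
    using Lp_limits_ind_borel[OF q T] by simp
qed

text \<open>
  A closed subspace that contains all indicators contains all simple functions, and these
  approximate every element of \<open>Lp p\<close> with domination. Rational rays are used as test functions
  because there are only countably many of them.
\<close>

theorem Lp_limits_eq_Lp:
  assumes q: "\<And>q. q \<in> \<rat> \<Longrightarrow> ind_L0 {..q} \<in> Lp_limits p W"
  shows "Lp_limits p W = Lp p"
proof
  show "Lp_limits p W \<subseteq> Lp p"
    by (auto simp: Lp_limits_def)
  show "Lp p \<subseteq> Lp_limits p W"
  proof
    fix f :: "'k L0" assume f: "f \<in> Lp p"
    note sub = subspace_Lp_limits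
    obtain f' where f'[measurable]: "f' \<in> borel_measurable (lebesgue_on {0..1})" and eq: "f = abs_L0 f'"
      by (rule L0_cases)
    obtain F where "(\<forall>n. simple_function (lebesgue_on {0..1}) (F n)) \<and>
        (\<forall>x\<in>space (lebesgue_on {0..1}). (\<lambda>n. F n x) \<longlonglongrightarrow> f' x) \<and>
        (\<forall>n. \<forall>x\<in>space (lebesgue_on {0..1}). dist (F n x) 0 \<le> 2 * dist (f' x) 0)"
      using borel_measurable_implies_sequence_metric[OF f', of 0] by (rule exE)
    then have F: "\<And>n. simple_function (lebesgue_on {0..1}) (F n)"
        "\<And>x. x \<in> {0..1} \<Longrightarrow> (\<lambda>n. F n x) \<longlonglongrightarrow> f' x"
        "\<And>n x. x \<in> {0..1} \<Longrightarrow> norm (F n x) \<le> 2 * norm (f' x)"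
      by (simp_all add: space_restrict_space)
    have simple: "abs_L0 s \<in> Lp_limits p W" if s: "simple_function (lebesgue_on {0..1}) s" for s
    proof -
      let ?A = "\<lambda>y. s -` {y} \<inter> {0..1}" and ?Y = "s ` {0..1}"
      have Y: "finite ?Y" and A: "?A y \<in> sets (lebesgue_on {0..1})" for y
        using simple_functionD[OF s] by (auto simp: space_restrict_space)
      then have A': "?A y \<in> sets lebesgue" for y
        by (simp add: sets_restrict_space_iff)
      note [measurable] = indicator_measurable_lebesgue_on[OF A']
      have sum: "abs_L0 (\<lambda>x. \<Sum>y\<in>Z. y * indicator (?A y) x) = (\<Sum>y\<in>Z. scaleL0 y (ind_L0 (?A y)))"
        if "finite Z" for Z
        using that
      proof (induction Z rule: finite_induct)
        case empty
        then show ?case by (simp add: abs_L0_arith)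
      next
        case (insert y Z)
        have "abs_L0 (\<lambda>x. \<Sum>z\<in>insert y Z. z * indicator (?A z) x)
            = abs_L0 (\<lambda>x. y * indicator (?A y) x + (\<Sum>z\<in>Z. z * indicator (?A z) x))"
          unfolding sum.insert[OF insert.hyps] ..
        also have "\<dots> = abs_L0 (\<lambda>x. y * indicator (?A y) x)
            + abs_L0 (\<lambda>x. \<Sum>z\<in>Z. z * indicator (?A z) x)"
          by (subst abs_L0_arith) simp_all
        also have "abs_L0 (\<lambda>x. y * indicator (?A y) x) = scaleL0 y (ind_L0 (?A y))"
          unfolding ind_L0_def by (subst abs_L0_arith) simp_all
        finally show ?case
          unfolding insert.IH sum.insert[OF insert.hyps] .
      qed
      have "abs_L0 s = abs_L0 (\<lambda>x. \<Sum>y\<in>?Y. y * indicator (?A y) x)"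
      proof (rule abs_L0_eqI)
        show "AE x in lebesgue_on {0..1}. s x = (\<Sum>y\<in>?Y. y * indicator (?A y) x)"
        proof (rule AE_I2)
          fix x assume "x \<in> space (lebesgue_on {0..1::real})"
          then have x: "x \<in> {0..1}"
            by (simp add: space_restrict_space)
          then have "(\<Sum>y\<in>?Y. y * indicator (?A y) x) = (\<Sum>y\<in>?Y. if y = s x then y else 0)"
            by (intro sum.cong) (auto simp: indicator_def)
          then show "s x = (\<Sum>y\<in>?Y. y * indicator (?A y) x)"
            using Y x by simp
        qed
      qed (use s borel_measurable_simple_function in auto)
      also have "\<dots> \<in> Lp_limits p W"
        unfolding sum[OF Y]
        by (intro subspace_sum[OF sub] subspace_scale[OF sub] Lp_limits_ind_lebesgue[OF q A'])
      finally show ?thesis .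
    qed
    have F_meas: "F n \<in> borel_measurable (lebesgue_on {0..1})" for n
      using F(1) by (rule borel_measurable_simple_function)
    have "abs_L0 f' \<in> Lp_limits p W"
    proof (rule Lp_limits_dominated[where F = F and b = "\<lambda>x. 2 * norm (f' x)"])
      show "integrable (lebesgue_on {0..1}) (\<lambda>x. (2 * norm (f' x)) powr p)"
        using f by (simp add: eq abs_L0_in_Lp_iff powr_mult)
    qed (use F F_meas simple in auto)
    then show "f \<in> Lp_limits p W"
      by (simp add: eq)
  qed
qed

end

corollary closure_eq_Lp_if_limits:
  assumes "p > 0" "module.subspace scaleL0 W" "W \<subseteq> Lp p"
    and "\<And>q. q \<in> \<rat> \<Longrightarrow> ind_L0 {..q} \<in> Lp_limits p W"
  shows "Lp_topology p closure_of W = topspace (Lp_topology p)"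
  using Lp_limits_eq_Lp[OF assms] Lp_limits_subset_closure[OF assms(1,3)] closure_of_subset_topspace[of "Lp_topology p" W]
  by (auto simp: topspace_Lp_topology)

section \<open>Spikes on dyadic intervals\<close>

definition dyadic :: "nat \<Rightarrow> real set" where
  "dyadic i = {(1/2) ^ Suc i<..(1/2) ^ i}"

text \<open>
  The index of the dyadic interval that contains \<open>x\<close>; meaningful for \<open>0 < x \<le> 1\<close> only.
\<close>

definition level :: "real \<Rightarrow> nat" where
  "level x = (LEAST i. (1/2) ^ Suc i < x)"

lemma level_measurable [measurable]: "level \<in> borel \<rightarrow>\<^sub>M count_space UNIV"
  unfolding level_def by measurable

lemma level_eq_iff:
  assumes "0 < x" "x \<le> 1"
  shows "x \<in> dyadic i \<longleftrightarrow> level x = i"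
proof
  obtain n where "(1/2) ^ n < x"
    using real_arch_pow_inv[OF assms(1), of "1/2"] by auto
  moreover have "(1/2 :: real) ^ Suc n \<le> (1/2) ^ n"
    by simp
  ultimately have "(1/2) ^ Suc n < x"
    by linarith
  then have "(1/2) ^ Suc (level x) < x"
    unfolding level_def by (rule LeastI)
  moreover have "x \<le> (1/2) ^ level x"
  proof (cases "level x")
    case (Suc j)
    then have "\<not> (1/2) ^ Suc j < x"
      using not_less_Least[of j "\<lambda>i. (1/2) ^ Suc i < x"] by (simp add: level_def)
    with Suc show ?thesis by simp
  qed (use assms in simp)
  ultimately have "x \<in> dyadic (level x)"
    by (simp add: dyadic_def)
  then show "level x = i \<Longrightarrow> x \<in> dyadic i"
    by simp
  show "level x = i" if "x \<in> dyadic i"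
    unfolding level_def
  proof (rule Least_equality)
    show "(1/2) ^ Suc i < x"
      using that by (simp add: dyadic_def)
    fix j :: nat assume "(1/2) ^ Suc j < x"
    then have "(1/2 :: real) ^ Suc j < (1/2) ^ i"
      using that unfolding dyadic_def by simp
    then have "i < Suc j"
      by (subst (asm) power_strict_decreasing_iff) auto
    then show "i \<le> j" by simp
  qed
qed

definition dyadic_step :: "(nat \<Rightarrow> real) \<Rightarrow> real \<Rightarrow> 'k::real_normed_field" where
  "dyadic_step a x = (if 0 < x \<and> x \<le> 1 then of_real (a (level x)) else 0)"

lemma dyadic_step_measurable:
  "dyadic_step a \<in> borel_measurable (lebesgue_on {0..1})"
proof -
  have "dyadic_step a \<in> borel_measurable borel"
    unfolding dyadic_step_def by measurable
  then show ?thesis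
    by (intro measurable_restrict_space1 measurable_completion) auto
qed

lemma nn_integral_dyadic_step:
  assumes "\<And>i. 0 \<le> a i"
  shows "(\<integral>\<^sup>+x. ennreal (dyadic_step a x) \<partial>lebesgue_on {0..1}) = (\<Sum>i. ennreal (a i * (1/2) ^ Suc i))"
proof -
  have dyadic_sub: "dyadic i \<subseteq> {0<..1}" for i
  proof -
    have "(1/2 :: real) ^ i \<le> 1"
      by (simp add: power_le_one)
    moreover have "(0 :: real) < (1/2) ^ Suc i"
      by simp
    ultimately show ?thesis
      unfolding dyadic_def greaterThanAtMost_iff subset_iff by (meson le_less_trans less_trans order_trans)
  qed
  have pointwise: "ennreal (dyadic_step a x) = (\<Sum>i. ennreal (a i) * indicator (dyadic i) x)" for x
  proof (cases "0 < x \<and> x \<le> 1")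
    case True
    then have "ennreal (a i) * indicator (dyadic i) x = (if i = level x then ennreal (a i) else 0)" for i
      using level_eq_iff[of x i] by (auto simp: indicator_def)
    then show ?thesis
      using True suminf_finite[of "{level x}" "\<lambda>i. if i = level x then ennreal (a i) else 0"]
      by (simp add: dyadic_step_def)
  next
    case False
    then have "indicator (dyadic i) x = (0 :: ennreal)" for i
      using dyadic_sub[of i] by (auto simp: indicator_def)
    with False show ?thesis
      by (auto simp: dyadic_step_def)
  qed
  have "(\<integral>\<^sup>+x. ennreal (dyadic_step a x) \<partial>lebesgue_on {0..1})
      = (\<Sum>i. \<integral>\<^sup>+x. ennreal (a i) * indicator (dyadic i) x \<partial>lebesgue_on {0..1})"
    unfolding pointwise
    by (intro nn_integral_suminf borel_measurable_times measurable_restrict_space1 measurable_completion)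
       (auto simp: dyadic_def)
  also have "\<dots> = (\<Sum>i. ennreal (a i * (1/2) ^ Suc i))"
  proof (rule suminf_cong)
    fix i
    have sub: "dyadic i \<subseteq> {0..1}"
      using dyadic_sub[of i] by auto
    have meas: "dyadic i \<in> sets lebesgue"
      by (simp add: dyadic_def)
    have "(\<integral>\<^sup>+x. ennreal (a i) * indicator (dyadic i) x \<partial>lebesgue_on {0..1})
        = ennreal (a i) * emeasure (lebesgue_on {0..1}) (dyadic i)"
      using sub meas by (intro nn_integral_cmult_indicator) (simp add: sets_restrict_space_iff)
    also have "emeasure (lebesgue_on {0..1}) (dyadic i) = emeasure lebesgue (dyadic i)"
      using sub by (intro emeasure_restrict_space) auto
    also have "\<dots> = ennreal ((1/2) ^ Suc i)"
      unfolding dyadic_def by (subst emeasure_completion) (auto simp: field_simps)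
    also have "ennreal (a i) * \<dots> = ennreal (a i * (1/2) ^ Suc i)"
      using assms by (intro ennreal_mult[symmetric]) auto
    finally show "(\<integral>\<^sup>+x. ennreal (a i) * indicator (dyadic i) x \<partial>lebesgue_on {0..1})
        = ennreal (a i * (1/2) ^ Suc i)" .
  qed
  finally show ?thesis .
qed

lemma norm_dyadic_step_powr:
  "norm (dyadic_step a x :: 'k::real_normed_field) powr q = dyadic_step (\<lambda>i. \<bar>a i\<bar> powr q) x"
  by (simp add: dyadic_step_def)

lemma dyadic_step_in_Lp_iff:
  "(abs_L0 (dyadic_step a) :: 'k::{real_normed_field, second_countable_topology} L0) \<in> Lp q \<longleftrightarrow>
    summable (\<lambda>i. \<bar>a i\<bar> powr q * (1/2) ^ Suc i)"
  (is "?l \<longleftrightarrow> summable ?c")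
proof -
  have c: "0 \<le> ?c i" for i
    by simp
  have "?l \<longleftrightarrow> integrable (lebesgue_on {0..1}) (dyadic_step (\<lambda>i. \<bar>a i\<bar> powr q) :: real \<Rightarrow> real)"
    by (simp add: abs_L0_in_Lp_iff dyadic_step_measurable norm_dyadic_step_powr)
  also have "\<dots> \<longleftrightarrow> (\<integral>\<^sup>+x. ennreal (dyadic_step (\<lambda>i. \<bar>a i\<bar> powr q) x) \<partial>lebesgue_on {0..1}) < \<infinity>"
    by (subst integrable_iff_bounded) (simp add: dyadic_step_measurable dyadic_step_def cong: if_cong)
  also have "\<dots> \<longleftrightarrow> (\<Sum>i. ennreal (?c i)) < \<infinity>"
    by (subst nn_integral_dyadic_step) auto
  also have "\<dots> \<longleftrightarrow> summable ?c"
  proof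
    assume "(\<Sum>i. ennreal (?c i)) < \<infinity>"
    then show "summable ?c"
      by (intro summable_suminf_not_top c) (metis infinity_ennreal_def less_irrefl)
  next
    assume "summable ?c"
    then have "(\<Sum>i. ennreal (?c i)) = ennreal (\<Sum>i. ?c i)"
      using c by (intro suminf_ennreal2)
    then show "(\<Sum>i. ennreal (?c i)) < \<infinity>"
      by (simp only: infinity_ennreal_def ennreal_less_top)
  qed
  finally show ?thesis .
qed

lemma Lp_modular_dyadic_step:
  assumes "summable (\<lambda>i. \<bar>a i\<bar> powr p * (1/2) ^ Suc i)"
  shows "Lp_modular p (abs_L0 (dyadic_step a) :: 'k::{real_normed_field, second_countable_topology} L0)
    = (\<Sum>i. \<bar>a i\<bar> powr p * (1/2) ^ Suc i)"
proof -
  have "Lp_modular p (abs_L0 (dyadic_step a) :: 'k L0)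
      = integral\<^sup>L (lebesgue_on {0..1}) (dyadic_step (\<lambda>i. \<bar>a i\<bar> powr p) :: real \<Rightarrow> real)"
    by (simp add: Lp_modular_abs dyadic_step_measurable norm_dyadic_step_powr)
  also have "\<dots> = (\<Sum>i. \<bar>a i\<bar> powr p * (1/2) ^ Suc i)"
  proof (rule integral_eq_nn_integral[THEN trans])
    show "AE x in lebesgue_on {0..1}. 0 \<le> (dyadic_step (\<lambda>i. \<bar>a i\<bar> powr p) x :: real)"
      by (simp add: dyadic_step_def)
    have "(\<Sum>i. ennreal (\<bar>a i\<bar> powr p * (1/2) ^ Suc i)) = ennreal (\<Sum>i. \<bar>a i\<bar> powr p * (1/2) ^ Suc i)"
      using assms by (intro suminf_ennreal2) auto
    moreover have "0 \<le> (\<Sum>i. \<bar>a i\<bar> powr p * (1/2) ^ Suc i)"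
      using assms by (intro suminf_nonneg) auto
    ultimately show "enn2real (\<integral>\<^sup>+x. ennreal (dyadic_step (\<lambda>i. \<bar>a i\<bar> powr p) x) \<partial>lebesgue_on {0..1})
        = (\<Sum>i. \<bar>a i\<bar> powr p * (1/2) ^ Suc i)"
      by (subst nn_integral_dyadic_step) simp_all
  qed (rule dyadic_step_measurable)
  finally show ?thesis .
qed

text \<open>
  The interval \<open>dyadic i\<close> has length \<open>2 powr (-(i + 1))\<close>, so a function with the value \<open>spike p i\<close>
  there contributes \<open>1 / (2 * (i + 1)\<^sup>2)\<close> to the \<open>p\<close>-th power integral, which is summable, whereas
  its contribution to the \<open>q\<close>-th power integral tends to infinity with \<open>i\<close> when \<open>q > p\<close>.
\<close>

definition spike :: "real \<Rightarrow> nat \<Rightarrow> real" where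
  "spike p i = (2 powr real i / (real i + 1)\<^sup>2) powr (1 / p)"

lemma spike_nonneg: "0 \<le> spike p i"
  by (simp add: spike_def)

lemma spike_powr: "spike p i powr q = (2 powr real i / (real i + 1)\<^sup>2) powr (q / p)"
  by (simp add: spike_def powr_powr)

text \<open>
  The dyadic intervals are distributed among infinitely many functions with disjoint supports by
  the pairing bijection: the \<open>k\<close>-th function lives on those intervals whose index encodes a pair with
  first component \<open>k\<close>. Each function gets infinitely many intervals, and only such of index at
  least \<open>k\<close>.
\<close>

definition spikes :: "real \<Rightarrow> nat \<Rightarrow> 'k::{real_normed_field, second_countable_topology} L0" where
  "spikes p k = abs_L0 (dyadic_step (\<lambda>i. if fst (prod_decode i) = k then spike p i else 0))"

lemma spikes_term:
  assumes "p > 0"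
  shows "\<bar>if fst (prod_decode i) = k then spike p i else 0\<bar> powr p * (1/2) ^ Suc i
    = (if fst (prod_decode i) = k then 1 / (2 * (real i + 1)\<^sup>2) else 0)"
proof (cases "fst (prod_decode i) = k")
  case True
  have "\<bar>spike p i\<bar> powr p = 2 ^ i / (real i + 1)\<^sup>2"
    using assms by (simp add: spike_nonneg spike_powr powr_realpow)
  with True show ?thesis
    by (simp add: field_simps)
qed simp

lemma summable_inverse_squares_half: "summable (\<lambda>i. 1 / (2 * (real i + 1)\<^sup>2))"
proof -
  have "summable (\<lambda>i. inverse (real i ^ 2))"
    by (rule inverse_power_summable) simp
  then have "summable (\<lambda>i. inverse (real (Suc i) ^ 2))"
    by (subst summable_Suc_iff)
  from summable_mult[OF this, of "1/2"] show ?thesis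
    by (simp add: field_simps)
qed

lemma summable_spikes:
  assumes "p > 0"
  shows "summable (\<lambda>i. \<bar>if fst (prod_decode i) = k then spike p i else 0\<bar> powr p * (1/2) ^ Suc i)"
  unfolding spikes_term[OF assms]
  by (rule summable_comparison_test'[OF summable_inverse_squares_half]) auto

lemma spikes_in_Lp: "p > 0 \<Longrightarrow> spikes p k \<in> Lp p"
  unfolding spikes_def dyadic_step_in_Lp_iff by (rule summable_spikes)

text \<open>
  All intervals used by \<open>spikes p k\<close> have index at least \<open>k\<close>, so its modular is at most the tail from
  \<open>k\<close> on of a convergent series.
\<close>

lemma spikes_modular_tendsto_0:
  assumes "p > 0"
  shows "(\<lambda>k. Lp_modular p (spikes p k :: 'k::{real_normed_field, second_countable_topology} L0)) \<longlonglongrightarrow> 0"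
proof (rule tendsto_sandwich[OF _ _ tendsto_const])
  let ?r = "\<lambda>i. 1 / (2 * (real i + 1)\<^sup>2)"
  show "(\<lambda>k. \<Sum>i. ?r (i + k)) \<longlonglongrightarrow> 0"
    unfolding LIMSEQ_iff using suminf_exist_split[OF _ summable_inverse_squares_half] by simp
  have "Lp_modular p (spikes p k :: 'k L0) \<le> (\<Sum>i. ?r (i + k))" for k
  proof -
    let ?s = "\<lambda>i. if fst (prod_decode i) = k then ?r i else 0"
    have s: "summable ?s"
      using summable_spikes[OF assms] unfolding spikes_term[OF assms] .
    have ge: "k \<le> i" if "fst (prod_decode i) = k" for i
      using le_prod_encode_1[of k "snd (prod_decode i)"] that by (metis prod.collapse prod_decode_inverse)
    have "Lp_modular p (spikes p k :: 'k L0) = suminf ?s"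
      unfolding spikes_def Lp_modular_dyadic_step[OF summable_spikes[OF assms]] spikes_term[OF assms] ..
    also have "\<dots> = (\<Sum>i. ?s (i + k)) + sum ?s {..<k}"
      using s by (rule suminf_split_initial_segment)
    also have "sum ?s {..<k} = 0"
      using ge by (intro sum.neutral) force
    also have "(\<Sum>i. ?s (i + k)) + 0 \<le> (\<Sum>i. ?r (i + k))"
      using summable_ignore_initial_segment[OF s, of k]
        summable_ignore_initial_segment[OF summable_inverse_squares_half, of k]
      by (simp only: add_0_right) (intro suminf_le, auto)
    finally show ?thesis .
  qed
  then show "\<forall>\<^sub>F k in sequentially. Lp_modular p (spikes p k :: 'k L0) \<le> (\<Sum>i. ?r (i + k))"
    by simp
qed (simp add: Lp_modular_nonneg)

text \<open>
  The integrals over the infinitely many intervals in the support would have to tend to \<open>0\<close>, but they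
  tend to infinity.
\<close>

lemma spikes_notin_Lp_above:
  assumes "p > 0"
  shows "(spikes p k :: 'k::{real_normed_field, second_countable_topology} L0) \<notin> Lp_above p"
proof
  assume "(spikes p k :: 'k L0) \<in> Lp_above p"
  then obtain q where q: "q > p" and mem: "(spikes p k :: 'k L0) \<in> Lp q"
    by (auto simp: Lp_above_def)
  define s where "s = q / p"
  have s: "s > 1"
    using assms q by (simp add: s_def)
  let ?t = "\<lambda>i. \<bar>if fst (prod_decode i) = k then spike p i else 0\<bar> powr q * (1/2) ^ Suc i"
  have "summable ?t"
    using mem unfolding spikes_def dyadic_step_in_Lp_iff .
  then have t: "?t \<longlonglongrightarrow> 0"
    by (rule summable_LIMSEQ_zero)
  define \<sigma> where "\<sigma> = (\<lambda>j. prod_encode (k, j))"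
  have \<sigma>: "filterlim \<sigma> at_top sequentially"
    unfolding \<sigma>_def by (rule filterlim_at_top_mono[OF filterlim_ident]) (simp add: le_prod_encode_2)
  have "(\<lambda>j. ?t (\<sigma> j)) \<longlonglongrightarrow> 0"
    using t \<sigma> by (rule filterlim_compose)
  moreover have "?t (\<sigma> j) = (2 powr real (\<sigma> j) / (real (\<sigma> j) + 1)\<^sup>2) powr s * (1/2) powr (real (\<sigma> j) + 1)" for j
    by (simp add: \<sigma>_def spike_powr s_def powr_add powr_realpow spike_nonneg)
  moreover have "filterlim (\<lambda>i. (2 powr real i / (real i + 1)\<^sup>2) powr s * (1/2) powr (real i + 1)) at_top sequentially"
  proof -
    define c where "c = (s - 1) * ln 2"
    have "c > 0"
      using s by (simp add: c_def)
    then have "filterlim (\<lambda>i. exp (c * real i - 2 * s * ln (real i + 1) - ln 2)) at_top sequentially"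
      by real_asymp
    moreover have "exp (c * real i - 2 * s * ln (real i + 1) - ln 2)
        = (2 powr real i / (real i + 1)\<^sup>2) powr s * (1/2) powr (real i + 1)" for i
      by (simp add: c_def powr_def ln_div ln_realpow algebra_simps flip: exp_add)
    ultimately show ?thesis
      by (simp only:)
  qed
  ultimately show False
    using filterlim_compose[OF _ \<sigma>] not_tendsto_and_filterlim_at_infinity
    by (metis (no_types, lifting) filterlim_at_top_imp_at_infinity sequentially_bot ext)
qed

definition spike_support :: "nat \<Rightarrow> real set" where
  "spike_support k = {x. 0 < x \<and> x \<le> 1 \<and> fst (prod_decode (level x)) = k}"

lemma spike_support_measurable: "spike_support k \<in> sets borel"
  unfolding spike_support_def by measurable

lemma mult_ind_spikes:
  "mult_L0 (ind_L0 (spike_support j)) (spikes p k) = (if j = k then spikes p k else 0)"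
  unfolding spikes_def ind_L0_def zero_L0.abs_eq
  by (subst mult_L0_abs)
    (auto intro!: arg_cong[where f = abs_L0] indicator_measurable_lebesgue_on dyadic_step_measurable
      simp: spike_support_measurable dyadic_step_def spike_support_def indicator_def fun_eq_iff)

section \<open>Dense lineability\<close>

lemma spikes_independent_modulo:
  assumes "p > 0"
  shows "inj (spikes p :: nat \<Rightarrow> 'k::{real_normed_field, second_countable_topology} L0)"
    and "\<not> module.dependent scaleL0 (range (spikes p :: nat \<Rightarrow> 'k L0))"
    and "module.span scaleL0 (range (spikes p :: nat \<Rightarrow> 'k L0)) \<inter> Lp_above p \<subseteq> {0}"
proof -
  interpret vector_space "scaleL0 :: 'k \<Rightarrow> _"
    by (rule vector_space_scaleL0)
  have P_above: "mult_L0 (ind_L0 (spike_support j)) f \<in> Lp_above p" if f: "f \<in> Lp_above p" for j and f :: "'k L0"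
  proof -
    obtain q where "q > p" "f \<in> Lp q"
      using f by (auto simp: Lp_above_def)
    moreover from this have "mult_L0 (ind_L0 (spike_support j)) f \<in> Lp q"
      using spike_support_measurable[of j] by (intro mult_ind_L0_in_Lp) auto
    ultimately show ?thesis
      by (auto simp: Lp_above_def)
  qed
  note * = independent_modulo_if_separated[OF subspace_Lp_above[OF assms] spikes_notin_Lp_above[OF assms]
      linear_mult_L0 P_above mult_ind_spikes[THEN trans]]
  show "inj (spikes p :: nat \<Rightarrow> 'k L0)"
    and "\<not> dependent (range (spikes p :: nat \<Rightarrow> 'k L0))"
    and "span (range (spikes p :: nat \<Rightarrow> 'k L0)) \<inter> Lp_above p \<subseteq> {0}"
    by (rule *; simp)+
qed

text \<open>
  Both scalar fields are instances of this statement. In the proof, \<open>d\<close> lists the indicators of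
  rational rays, each infinitely often, and the spikes \<open>g (\<sigma> k)\<close> added to them tend to \<open>0\<close>; so
  every such indicator is a limit of vectors \<open>d k + g (\<sigma> k)\<close>.
\<close>

theorem dense_lineable_Lp_minus_Lp_above:
  fixes p :: real and n :: nat
  assumes p: "0 < p"
  shows "dense_lineable scaleL0 (Lp_topology p) |{..<n}| natLeq
    (Lp p - Lp_above p :: 'k::{real_normed_field, second_countable_topology} L0 set)"
proof -
  interpret vector_space "scaleL0 :: 'k \<Rightarrow> _"
    by (rule vector_space_scaleL0)
  let ?U = "Lp_above p :: 'k L0 set" and ?g = "spikes p :: nat \<Rightarrow> 'k L0"
  have U: "subspace ?U" and U_sub: "?U \<subseteq> Lp p" and V: "subspace (Lp p :: 'k L0 set)"
    using p by (simp_all add: subspace_Lp_above Lp_above_subset subspace_Lp)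
  have g: "inj ?g" "independent (range ?g)" "span (range ?g) \<inter> ?U \<subseteq> {0}" "\<And>k. ?g k \<in> Lp p"
    using p by (rule spikes_independent_modulo spikes_in_Lp)+
  \<comment> \<open>Lineability of the difference is a statement about subspaces that meet \<open>?U\<close> trivially.\<close>
  have in_A: "W \<subseteq> Lp p - ?U \<union> {0} \<longleftrightarrow> W \<subseteq> Lp p \<and> W \<inter> ?U \<subseteq> {0}" if "subspace W" for W
    using subspace_0[OF V] by blast
  have lineable: "lineable scaleL0 |{..<n}| (Lp p - ?U)"
    unfolding lineable_def dim_subspace_def
  proof (intro exI conjI)
    let ?B = "?g ` {..<n}"
    show "subspace (span ?B)"
      by (rule subspace_span)
    show "independent ?B"
      using g(2) by (rule independent_mono) auto
    have "bij_betw ?g {..<n} ?B"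
      using g(1) by (auto simp: bij_betw_def intro: inj_on_subset)
    then show "|?B| =o |{..<n}|"
      by (intro card_of_ordIsoI) (rule bij_betw_inv_into)
    have "span ?B \<subseteq> span (range ?g)"
      by (intro span_mono) auto
    moreover have "span ?B \<subseteq> Lp p"
      using g(4) by (intro span_minimal V) auto
    ultimately show "span ?B \<subseteq> Lp p - ?U \<union> {0}"
      using g(3) by (subst in_A[OF subspace_span]) auto
  qed simp
  have extend: "\<exists>W'. dim_subspace scaleL0 natLeq W' \<and>
      Lp_topology p closure_of W' = topspace (Lp_topology p) \<and> W \<subseteq> W' \<and> W' \<subseteq> Lp p - ?U \<union> {0}"
    if W: "dim_subspace scaleL0 |{..<n}| W" "W \<subseteq> Lp p - ?U \<union> {0}" for W
  proof -
    obtain B where B: "independent B" "span B = W" "|B| =o |{..<n}|" and "subspace W"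
      using W(1) unfolding dim_subspace_def by blast
    then have WU: "W \<subseteq> Lp p" "W \<inter> ?U \<subseteq> {0}"
      using W(2) in_A by blast+
    have "finite B"
      using card_of_ordIso_finite[OF B(3)] by simp
    obtain \<sigma> :: "nat \<Rightarrow> nat" where "strict_mono \<sigma>"
      and \<sigma>: "\<And>d. range d \<subseteq> ?U \<Longrightarrow> inj (\<lambda>k. d k + ?g (\<sigma> k)) \<and>
        independent (B \<union> range (\<lambda>k. d k + ?g (\<sigma> k))) \<and>
        span (B \<union> range (\<lambda>k. d k + ?g (\<sigma> k))) \<inter> ?U \<subseteq> {0}"
      using extend_modulo_perturbed[OF U \<open>finite B\<close> B(1) WU(2)[folded B(2)] g(1-3)] by blast
    define d :: "nat \<Rightarrow> 'k L0" where "d k = ind_L0 {..real_of_rat (from_nat (fst (prod_decode k)))}" for k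
    have d: "range d \<subseteq> ?U"
      using p by (auto simp: d_def intro: ind_L0_in_Lp_above)
    let ?h = "\<lambda>k. d k + ?g (\<sigma> k)"
    let ?D = "B \<union> range ?h" and ?W = "span (B \<union> range ?h)"
    note D = \<sigma>[OF d]
    have "?h k \<in> Lp p" for k
      using d U_sub g(4) by (intro subspace_add[OF V]) auto
    moreover have "B \<subseteq> Lp p"
      using WU(1) B(2) span_superset by blast
    ultimately have W_sub: "?W \<subseteq> Lp p"
      by (intro span_minimal V) auto
    have "Lp_topology p closure_of ?W = topspace (Lp_topology p)"
    proof (rule closure_eq_Lp_if_limits[OF p subspace_span W_sub])
      fix q :: real assume "q \<in> \<rat>"
      then obtain r where r: "q = real_of_rat r"
        by (auto elim: Rats_cases)
      \<comment> \<open>The positions at which the ray \<open>{..q}\<close> occurs in \<open>d\<close>.\<close>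
      define k where "k = (\<lambda>m. prod_encode (to_nat r, m))"
      have dk: "d (k m) = ind_L0 {..q}" for m
        by (simp add: d_def k_def r)
      have "filterlim (\<lambda>m. \<sigma> (k m)) at_top sequentially"
      proof (rule filterlim_at_top_mono[OF filterlim_ident])
        have "m \<le> k m" for m
          by (simp add: k_def le_prod_encode_2)
        then show "\<forall>\<^sub>F m in sequentially. m \<le> \<sigma> (k m)"
          using seq_suble[OF \<open>strict_mono \<sigma>\<close>] order_trans by (intro always_eventually) blast
      qed
      then have lim: "(\<lambda>m. Lp_modular p (?g (\<sigma> (k m)))) \<longlonglongrightarrow> 0"
        using spikes_modular_tendsto_0[OF p] by (rule filterlim_compose[rotated])
      show "ind_L0 {..q} \<in> Lp_limits p ?W"
        unfolding Lp_limits_def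
      proof (intro CollectI conjI allI impI)
        show "ind_L0 {..q} \<in> Lp p"
          using p by (intro ind_L0_in_Lp) auto
        fix e :: real assume "e > 0"
        then have "\<forall>\<^sub>F m in sequentially. Lp_modular p (?g (\<sigma> (k m))) < e"
          by (rule order_tendstoD(2)[OF lim])
        then obtain m where "Lp_modular p (?g (\<sigma> (k m))) < e"
          by (auto simp: eventually_sequentially)
        moreover have "?h (k m) \<in> ?W"
          by (intro span_base) auto
        moreover have "?h (k m) - ind_L0 {..q} = ?g (\<sigma> (k m))"
          by (simp add: dk)
        ultimately show "\<exists>f\<in>?W. Lp_modular p (f - ind_L0 {..q}) < e"
          by metis
      qed
    qed
    moreover have "dim_subspace scaleL0 natLeq ?W"
      unfolding dim_subspace_def
    proof (intro conjI exI)
      have "countable ?D" "infinite ?D"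
        using \<open>finite B\<close> D finite_imageD[of ?h UNIV] by (auto simp: countable_finite)
      then have "|?D| =o |UNIV :: nat set|"
        by (rule card_of_ordIsoI[OF to_nat_on_infinite])
      then show "|?D| =o natLeq"
        using card_of_nat ordIso_transitive by blast
    qed (use D in auto)
    moreover have "W \<subseteq> ?W"
      using B(2) span_mono[of B ?D] by auto
    moreover have "?W \<subseteq> Lp p - ?U \<union> {0}"
      using W_sub D by (subst in_A[OF subspace_span]) auto
    ultimately show ?thesis
      by blast
  qed
  have "?g 0 \<in> Lp p - ?U"
    using g(4) spikes_notin_Lp_above[OF p] by auto
  then have "Lp p - ?U \<noteq> {}"
    by blast
  with lineable extend show ?thesis
    unfolding dense_lineable_def topspace_Lp_topology by (intro conjI allI impI) simp_all
qed

theorem corollary4p4: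
  fixes p :: real and n :: nat
  assumes "0 < p" and "1 \<le> n"
  shows "dense_lineable scaleL0 (Lp_topology p) |{..<n}| natLeq
           (Lp p - (\<Union>q\<in>{p<..}. Lp q) :: real L0 set) \<and>
         dense_lineable scaleL0 (Lp_topology p) |{..<n}| natLeq
           (Lp p - (\<Union>q\<in>{p<..}. Lp q) :: complex L0 set)"
  using assms(1) by (intro conjI dense_lineable_Lp_minus_Lp_above[unfolded Lp_above_def])

end
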